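(* Let $M$ be an Orlicz function which is $\mathcal{C}^3$ on $[0,+\infty)$, such that $M^{(3)}$ is increasing, $M(t)=o(t^3)$ when $t\to 0$, and $M$ satisfies the $\Delta_{2++}$-condition at $0$. Suppose additionally that $M(1)=1$, and that for every $\varepsilon>0$ there exists $\alpha(\varepsilon)>1$ such that for every $0<t,u\leqslant 1-\varepsilon$, it holds that $M(tu)\geqslant\alpha(\varepsilon)M(t)M(u)$. Let $X=\ell_M$ or $X=\ell_M^n$ for some $n\in\mathbb{N}$. Then all linear isometric embeddings $X\to\ell_M$ map basic vectors to multiples of basic vectors.
   Context: All spaces are real. An Orlicz function is a convex function $M\colon[0,+\infty)\to[0,+\infty)$ with $M(0)=0$ and $\lim_{t\to\infty}M(t)=\infty$. For a real sequence $x=(x(k))_{k\in\mathbb{N}}$, the Luxemburg norm is $\|x\|_M=\inf\{\rho>0 : \sum_k M(|x(k)|/\rho)\leqslant 1\}$ (with $\inf\varnothing=+\infty$); the Orlicz sequence space is $\ell_M=\{x\in\mathbb{R}^{\mathbb{N}} : \|x\|_M<\infty\}$ with the norm $\|\cdot\|_M$. The space $\ell_M^n$ is $\mathbb{R}^n$ with the norm defined in the same way on sequences indexed by $\{1,\dots,n\}$. A basic vector of $\ell_M$ or $\ell_M^n$ is a vector $e_k$ of the canonical basis. An Orlicz function $M$ of class $\mathcal{C}^3$ on $(0,+\infty)$ satisfies the $\Delta_{2++}$-condition at $0$ if for every $i\in\{1,2,3\}$, $\limsup_{t\to 0}\frac{tM^{(i)}(t)}{M^{(i-1)}(t)}<\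infty$.
   Formalization: The case X = ℓ_M^n with n = 1 is excluded, since the claim fails there: if M(c) = 1/2, then e_1 ↦ (c, c, 0, …) is a linear isometric embedding of ℓ_M^1 into ℓ_M whose image of e_1 is not a multiple of a basic vector. *)

theory Defs
  imports "HOL-Analysis.Analysis" "HOL-Library.Landau_Symbols"
begin

text \<open>
  An Orlicz function is a function on \<open>[0,\<infinity>)\<close>; it is represented by a total function
  \<open>M :: real \<Rightarrow> real\<close> of which only the values on \<open>{0..}\<close> are ever used.
\<close>

definition orlicz_function :: "(real \<Rightarrow> real) \<Rightarrow> bool" where
  "orlicz_function M \<longleftrightarrow>
     (\<forall>t\<ge>0. M t \<ge> 0) \<and> convex_on {0..} M \<and> M 0 = 0 \<and> filterlim M at_top at_top"

text \<open>
  Derivatives are taken within \<open>{0..}\<close>: they are one-sided at \<open>0\<close> and ordinary derivatives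
  at every \<open>t > 0\<close>.
\<close>

primrec deriv_nonneg :: "nat \<Rightarrow> (real \<Rightarrow> real) \<Rightarrow> real \<Rightarrow> real" where
  "deriv_nonneg 0 M = M"
| "deriv_nonneg (Suc i) M = (\<lambda>t. vector_derivative (deriv_nonneg i M) (at t within {0..}))"

definition C3_nonneg :: "(real \<Rightarrow> real) \<Rightarrow> bool" where
  "C3_nonneg M \<longleftrightarrow>
     (\<forall>i<3. deriv_nonneg i M differentiable_on {0..}) \<and> continuous_on {0..} (deriv_nonneg 3 M)"

definition Delta2pp :: "(real \<Rightarrow> real) \<Rightarrow> bool" where
  "Delta2pp M \<longleftrightarrow>
     (\<forall>i\<in>{1,2,3}.
        Limsup (at_right 0) (\<lambda>t. ereal (t * deriv_nonneg i M t / deriv_nonneg (i - 1) M t)) < \<infinity>)"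

text \<open>
  Sequences indexed by a set \<open>I\<close> of naturals are functions \<open>nat \<Rightarrow> real\<close> vanishing outside \<open>I\<close>.
  Thus \<open>\<ell>\<^sub>M\<close> is the case \<open>I = UNIV\<close>, and \<open>\<ell>\<^sub>M\<^sup>n\<close> is the case \<open>I = {1..n}\<close>.  The sum is taken in
  \<open>[0,\<infinity>]\<close>, and so is the infimum (hence the infimum of the empty set is \<open>\<infinity>\<close>).
\<close>

definition luxemburg_norm :: "(real \<Rightarrow> real) \<Rightarrow> nat set \<Rightarrow> (nat \<Rightarrow> real) \<Rightarrow> ennreal" where
  "luxemburg_norm M I x =
     Inf {ennreal \<rho> | \<rho>. \<rho> > 0 \<and> (\<Sum>\<^sub>\<infinity>k\<in>I. ennreal (M (\<bar>x k\<bar> / \<rho>))) \<le> 1}"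

definition orlicz_space :: "(real \<Rightarrow> real) \<Rightarrow> nat set \<Rightarrow> (nat \<Rightarrow> real) set" where
  "orlicz_space M I = {x. (\<forall>k. k \<notin> I \<longrightarrow> x k = 0) \<and> luxemburg_norm M I x < \<infinity>}"

definition basic_vector :: "nat \<Rightarrow> nat \<Rightarrow> real" where
  "basic_vector k = (\<lambda>j. if j = k then 1 else 0)"

text \<open>
  Linear isometric embeddings of the space indexed by \<open>I\<close> into \<open>\<ell>\<^sub>M\<close>.  The values of \<open>T\<close>
  outside \<open>orlicz_space M I\<close> are irrelevant.  If \<open>I\<close> is a singleton, the space is
  one-dimensional and its basic vector can be sent to any vector of the same norm in \<open>\<ell>\<^sub>M\<close>.
\<close>

definition linear_isometric_embedding ::
    "(real \<Rightarrow> real) \<Rightarrow> nat set \<Rightarrow> ((nat \<Rightarrow> real) \<Rightarrow> nat \<Rightarrow> real) \<Rightarrow> bool" where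
  "linear_isometric_embedding M I T \<longleftrightarrow>
     (\<forall>x\<in>orlicz_space M I. T x \<in> orlicz_space M UNIV) \<and>
     (\<forall>x\<in>orlicz_space M I. \<forall>y\<in>orlicz_space M I. T (\<lambda>k. x k + y k) = (\<lambda>k. T x k + T y k)) \<and>
     (\<forall>x\<in>orlicz_space M I. \<forall>a. T (\<lambda>k. a * x k) = (\<lambda>k. a * T x k)) \<and>
     (\<forall>x\<in>orlicz_space M I. luxemburg_norm M UNIV (T x) = luxemburg_norm M I x)"

end

theory Submission
  imports Defs
begin

text \<open>
  Write \<open>f\<close> and \<open>g\<close> for the images of two distinct basic vectors \<open>e\<^sub>k\<close> and \<open>e\<^sub>j\<close>.  The whole proof
  compares the modular \<open>\<Sum>\<^sub>i M \<bar>x i\<bar>\<close> of combinations of \<open>f\<close> and \<open>g\<close> with an upper bound for the norm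
  of the same combination of \<open>e\<^sub>k\<close> and \<open>e\<^sub>j\<close>.

  The hypotheses are first turned into three analytic facts.  Supermultiplicativity prevents \<open>M\<close> from
  vanishing away from \<open>0\<close>, since a positive value at some \<open>b < 1\<close> propagates to all powers of \<open>b\<close>
  (\<open>supermultiplicative_imp_pos\<close>).  The first part of the \<open>\<Delta>\<^sub>2\<^sub>+\<^sub>+\<close> condition bounds
  \<open>s * M' s / M s\<close> on \<open>(0, 2]\<close>, so \<open>M\<close> loses at most a factor \<open>1 - C * (1 - l)\<close> when its argument is
  scaled by \<open>l\<close> (\<open>elasticity_imp_doubling\<close>); hence vectors of norm one have modular exactly one
  (\<open>modular_eq_one\<close>).  Monotonicity of the third derivative and flatness at \<open>0\<close> make the second derivative
  positive and nondecreasing on \<open>(0, \<infinity>)\<close>, so second differences of \<open>M\<close> away from \<open>0\<close> are at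
  least of order \<open>h\<^sup>2\<close> (\<open>uniformly_curved\<close>).

  The supports of \<open>f\<close> and \<open>g\<close> are disjoint (\<open>disjoint_supports\<close>).  By convexity \<open>e\<^sub>k \<plusminus> t e\<^sub>j\<close> has norm at
  most \<open>1 + M t\<close>, so the modulars of \<open>f + t g\<close> and \<open>f - t g\<close>, after division of the vectors by
  \<open>1 + M t\<close>, are at most \<open>1\<close>.  The vector \<open>f\<close> divided by \<open>1 + M t\<close> has modular at least \<open>1 - C * M t\<close>.
  Hence the second differences of \<open>M\<close>, summed over all coordinates, are \<open>O(M t)\<close>, that is
  \<open>o(t\<^sup>2)\<close>.  Each of them is nonnegative, and one at a coordinate where both \<open>f\<close> and \<open>g\<close> are
  nonzero would already be of order \<open>t\<^sup>2\<close>.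

  Finally, \<open>f\<close> has one nonzero coordinate (\<open>single_support\<close>).  Choose \<open>v\<close> with \<open>M v = 1/2\<close>; then
  \<open>e\<^sub>k + e\<^sub>j\<close> has norm at most \<open>1 / v\<close>, so the modular of \<open>v (f + g)\<close> is at most \<open>1\<close>.  By disjointness and
  \<open>M (v * s) \<ge> M v * M s\<close> it is also at least \<open>1/2 + 1/2\<close>.  Equality forces \<open>M (v * s) = M v * M s\<close> for
  the modulus \<open>s\<close> of every coordinate, and as this fails for \<open>0 < s < 1\<close>, all coordinates of \<open>f\<close> are
  \<open>0\<close> or \<open>\<plusminus>1\<close>.  A vector of modular one with such coordinates is \<open>\<plusminus>\<close> a basic vector.
\<close>

section \<open>The Luxemburg norm and the modular\<close>

text \<open>
  This moves the condition in the Luxemburg norm from extended to real sums, where terms can be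
  subtracted and compared strictly.
\<close>

lemma infsum_ennreal_le_one_iff:
  fixes f :: "'a \<Rightarrow> real"
  assumes f: "\<And>k. k \<in> A \<Longrightarrow> 0 \<le> f k"
  shows "(\<Sum>\<^sub>\<infinity>k\<in>A. ennreal (f k)) \<le> 1 \<longleftrightarrow> (\<exists>s\<le>1. (f has_sum s) A)"
proof
  assume le: "(\<Sum>\<^sub>\<infinity>k\<in>A. ennreal (f k)) \<le> 1"
  have fin: "sum f F \<le> 1" if F: "finite F" "F \<subseteq> A" for F
  proof -
    have "ennreal (sum f F) = (\<Sum>k\<in>F. ennreal (f k))"
      using f F(2) by (intro sum_ennreal[symmetric]) auto
    also have "\<dots> \<le> (\<Sum>\<^sub>\<infinity>k\<in>A. ennreal (f k))"
      unfolding nonneg_infsum_complete[of A "\<lambda>k. ennreal (f k)", simplified]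
      using F by (intro SUP_upper) auto
    also note le
    finally show ?thesis
      by simp
  qed
  then have "f summable_on A"
    using f by (intro nonneg_bdd_above_summable_on) (auto intro!: bdd_aboveI2[where M = 1])
  then have hs: "(f has_sum infsum f A) A"
    by (rule has_sum_infsum)
  moreover have "infsum f A \<le> 1"
    using hs fin by (rule has_sum_le_finite_sums)
  ultimately show "\<exists>s\<le>1. (f has_sum s) A"
    by blast
next
  assume "\<exists>s\<le>1. (f has_sum s) A"
  then obtain s where s: "s \<le> 1" "(f has_sum s) A"
    by blast
  show "(\<Sum>\<^sub>\<infinity>k\<in>A. ennreal (f k)) \<le> 1"
  proof (rule infsum_le_finite_sums)
    show "(\<lambda>k. ennreal (f k)) summable_on A"
      by (simp add: nonneg_summable_on_complete)
    fix F assume F: "finite F" "F \<subseteq> A"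
    have "sum f F \<le> s"
      using s(2) F f by (intro finite_sum_le_has_sum[where A = A]) auto
    with s(1) have "ennreal (sum f F) \<le> ennreal 1"
      by (intro ennreal_leI) simp
    then show "(\<Sum>k\<in>F. ennreal (f k)) \<le> 1"
      using f F(2) by (subst sum_ennreal) auto
  qed
qed

text \<open>
  The assumption on \<open>C\<close> is a derivative-free form of the bound \<open>s * M' s \<le> C * M s\<close> for
  \<open>0 < s \<le> 2\<close>.  The range up to \<open>2\<close> leaves room to stretch a vector of norm one, whose
  coordinates lie in \<open>[-1, 1]\<close>, by a factor slightly larger than one.
\<close>

locale orlicz_doubling =
  fixes M :: "real \<Rightarrow> real" and C :: real
  assumes orlicz: "orlicz_function M"
    and cont: "continuous_on {0..} M"
    and one: "M 1 = 1"
    and pos: "\<And>t. 0 < t \<Longrightarrow> 0 < M t"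
    and C_nonneg: "0 \<le> C"
    and doubling: "\<And>s l. 0 \<le> s \<Longrightarrow> s \<le> 2 \<Longrightarrow> 0 \<le> l \<Longrightarrow> l \<le> 1 \<Longrightarrow> (1 - C * (1 - l)) * M s \<le> M (l * s)"
begin

lemma nonneg: "0 \<le> t \<Longrightarrow> 0 \<le> M t"
  and zero: "M 0 = 0"
  and convex: "convex_on {0..} M"
  using orlicz by (auto simp: orlicz_function_def)

lemma shrink: "M (l * t) \<le> l * M t" if "0 \<le> l" "l \<le> 1" "0 \<le> t"
  using convex_onD[OF convex, of l 0 t] that zero by simp

lemma strict_mono_nonneg: "M s < M t" if "0 \<le> s" "s < t"
proof -
  have "M s \<le> s / t * M t"
    using shrink[of "s / t" t] that by simp
  also have "\<dots> < 1 * M t"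
    using that pos[of t] by (intro mult_strict_right_mono) auto
  finally show ?thesis by simp
qed

lemma mono_nonneg: "M s \<le> M t" if "0 \<le> s" "s \<le> t"
  using strict_mono_nonneg[of s t] that by (cases "s = t") auto

lemma le_one_iff: "M t \<le> 1 \<longleftrightarrow> t \<le> 1" if "0 \<le> t"
  using strict_mono_nonneg[of 1 t] mono_nonneg[of t 1] one that by fastforce

lemma luxemburg_norm_leI:
  assumes "0 < N" "s \<le> 1" "((\<lambda>k. M (\<bar>x k\<bar> / N)) has_sum s) I"
  shows "luxemburg_norm M I x \<le> ennreal N"
proof -
  have "(\<Sum>\<^sub>\<infinity>k\<in>I. ennreal (M (\<bar>x k\<bar> / N))) \<le> 1"
    using assms by (subst infsum_ennreal_le_one_iff) (auto intro: nonneg)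
  then show ?thesis
    unfolding luxemburg_norm_def using assms(1) by (intro Inf_lower) auto
qed

text \<open>
  The infimum defining the norm is attained: finite partial sums at \<open>N\<close> are limits of those at \<open>r > N\<close>
  because \<open>M\<close> is continuous.
\<close>

lemma luxemburg_norm_leD:
  assumes N: "0 < N" and le: "luxemburg_norm M I x \<le> ennreal N"
  obtains s where "s \<le> 1" "((\<lambda>k. M (\<bar>x k\<bar> / N)) has_sum s) I"
proof -
  have above: "(\<Sum>k\<in>F. M (\<bar>x k\<bar> / r)) \<le> 1" if r: "N < r" and F: "finite F" "F \<subseteq> I" for r F
  proof -
    have "luxemburg_norm M I x < ennreal r"
      using le r N by (intro le_less_trans[OF le] ennreal_lessI) auto
    then obtain q where q: "0 < q" "(\<Sum>\<^sub>\<infinity>k\<in>I. ennreal (M (\<bar>x k\<bar> / q))) \<le> 1" "ennreal q < ennreal r"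
      unfolding luxemburg_norm_def Inf_less_iff by blast
    have qr: "q < r"
      using q(1,3) by (simp add: ennreal_less_iff)
    obtain s where s: "s \<le> 1" "((\<lambda>k. M (\<bar>x k\<bar> / q)) has_sum s) I"
      using q(1,2) by (subst (asm) infsum_ennreal_le_one_iff) (auto intro: nonneg)
    have "(\<Sum>k\<in>F. M (\<bar>x k\<bar> / r)) \<le> (\<Sum>k\<in>F. M (\<bar>x k\<bar> / q))"
      using q(1) qr by (intro sum_mono mono_nonneg) (auto intro: divide_left_mono)
    also have "\<dots> \<le> s"
      using s(2) F q(1) by (intro finite_sum_le_has_sum[where A = I]) (auto intro: nonneg)
    finally show ?thesis using s(1) by simp
  qed
  have fin: "(\<Sum>k\<in>F. M (\<bar>x k\<bar> / N)) \<le> 1" if F: "finite F" "F \<subseteq> I" for F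
  proof -
    have "((\<lambda>r. \<Sum>k\<in>F. M (\<bar>x k\<bar> / r)) \<longlongrightarrow> (\<Sum>k\<in>F. M (\<bar>x k\<bar> / N))) (at_right N)"
    proof (intro tendsto_sum continuous_on_tendsto_compose[OF cont])
      show "((\<lambda>r. \<bar>x k\<bar> / r) \<longlongrightarrow> \<bar>x k\<bar> / N) (at_right N)" for k
        using N by (intro tendsto_intros) auto
      show "\<forall>\<^sub>F r in at_right N. \<bar>x k\<bar> / r \<in> {0..}" for k
        using N by (auto simp: eventually_at_right_less intro!: eventually_mono[OF eventually_at_right_less[of N]])
    qed (use N in auto)
    moreover have "\<forall>\<^sub>F r in at_right N. (\<Sum>k\<in>F. M (\<bar>x k\<bar> / r)) \<le> 1"
      using eventually_at_right_less[of N] above F by (auto elim!: eventually_mono)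
    ultimately show ?thesis
      by (rule tendsto_upperbound) simp
  qed
  have "(\<lambda>k. M (\<bar>x k\<bar> / N)) summable_on I"
  proof (rule nonneg_bdd_above_summable_on)
    show "0 \<le> M (\<bar>x k\<bar> / N)" for k
      using N by (intro nonneg) simp
    show "bdd_above (sum (\<lambda>k. M (\<bar>x k\<bar> / N)) ` {F. F \<subseteq> I \<and> finite F})"
      using fin by (intro bdd_aboveI2[of _ _ 1]) simp
  qed
  then have hs: "((\<lambda>k. M (\<bar>x k\<bar> / N)) has_sum infsum (\<lambda>k. M (\<bar>x k\<bar> / N)) I) I"
    by (rule has_sum_infsum)
  show ?thesis
    using that[OF has_sum_le_finite_sums[OF hs fin] hs] by blast
qed

lemma le_one_of_modular:
  assumes "((\<lambda>k. M \<bar>x k\<bar>) has_sum s) I" "s \<le> 1" "k \<in> I"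
  shows "\<bar>x k\<bar> \<le> 1"
proof -
  have "(\<Sum>k\<in>{k}. M \<bar>x k\<bar>) \<le> s"
    using assms by (intro finite_sum_le_has_sum[where A = I]) (auto intro: nonneg)
  then show ?thesis
    using assms(2) le_one_iff[of "\<bar>x k\<bar>"] by simp
qed

text \<open>
  If the modular were \<open>s < 1\<close>, the growth condition would leave room to stretch \<open>x\<close> by a factor
  \<open>1 / (1 - h)\<close> while keeping the modular at most \<open>1\<close>, and the norm would be at most \<open>1 - h\<close>.
\<close>

lemma modular_eq_one:
  assumes "luxemburg_norm M I x = 1"
  shows "((\<lambda>k. M \<bar>x k\<bar>) has_sum 1) I"
proof -
  obtain s where s: "s \<le> 1" "((\<lambda>k. M \<bar>x k\<bar>) has_sum s) I"
    using luxemburg_norm_leD[of 1 I x] assms by auto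
  note x1 = le_one_of_modular[OF s(2,1)]
  have s0: "0 \<le> s"
    using s(2) by (rule has_sum_nonneg) (simp add: nonneg)
  have "s = 1"
  proof (rule ccontr)
    assume "s \<noteq> 1"
    with s(1) have "s < 1" by simp
    \<comment> \<open>Stretching by \<open>1 / (1 - h)\<close> multiplies the modular by at most \<open>1 / (1 - C * h)\<close>, so
      \<open>C * h \<le> 1 - s\<close> is needed.\<close>
    define h where "h = (1 - s) / 2 / (C + 1)"
    have h: "0 < h" "h \<le> 1 / 2" and Ch: "C * h \<le> 1 - s" "C * h < 1"
    proof -
      have *: "h * (C + 1) = (1 - s) / 2"
        unfolding h_def using C_nonneg by (intro nonzero_eq_divide_eq[THEN iffD1]) auto
      show "0 < h"
        using C_nonneg \<open>s < 1\<close> by (simp add: h_def)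
      then have "0 \<le> C * h"
        using C_nonneg by simp
      with * \<open>0 < h\<close> s0 \<open>s < 1\<close> show "h \<le> 1 / 2" "C * h \<le> 1 - s" "C * h < 1"
        by (simp_all add: algebra_simps)
    qed
    have hs: "((\<lambda>k. 1 / (1 - C * h) * M \<bar>x k\<bar>) has_sum (1 / (1 - C * h) * s)) I"
      using s(2) by (rule has_sum_cmult_right)
    have le: "M (\<bar>x k\<bar> / (1 - h)) \<le> 1 / (1 - C * h) * M \<bar>x k\<bar>" if "k \<in> I" for k
    proof -
      have "\<bar>x k\<bar> / (1 - h) \<le> 2"
        using x1[OF that] h by (simp add: field_simps)
      then have "(1 - C * h) * M (\<bar>x k\<bar> / (1 - h)) \<le> M \<bar>x k\<bar>"
        using doubling[of "\<bar>x k\<bar> / (1 - h)" "1 - h"] h by simp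
      then show ?thesis
        using Ch by (simp add: field_simps)
    qed
    have "(\<lambda>k. M (\<bar>x k\<bar> / (1 - h))) summable_on I"
      using h by (intro summable_on_comparison_test[OF has_sum_imp_summable[OF hs] le]) (auto intro: nonneg)
    then obtain s' where s': "((\<lambda>k. M (\<bar>x k\<bar> / (1 - h))) has_sum s') I"
      unfolding summable_on_def by blast
    have "s' \<le> 1 / (1 - C * h) * s"
      using s' hs le by (rule has_sum_mono)
    also have "\<dots> \<le> 1"
      using Ch by (simp add: field_simps)
    finally have "luxemburg_norm M I x \<le> ennreal (1 - h)"
      using h s' by (intro luxemburg_norm_leI) auto
    also have "\<dots> < ennreal 1"
      using h by (intro ennreal_lessI) auto
    finally show False
      using assms by simp
  qed
  with s show ?thesis by simp
qed

lemma has_sum_two_point: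
  assumes "k \<in> I" "j \<in> I" "k \<noteq> j" "0 < N"
  shows "((\<lambda>i. M (\<bar>a * basic_vector k i + b * basic_vector j i\<bar> / N)) has_sum (M (\<bar>a\<bar> / N) + M (\<bar>b\<bar> / N))) I"
  using assms by (intro has_sum_finite_neutralI[of "{k, j}"]) (auto simp: basic_vector_def zero)

lemma two_point_norm_le:
  assumes "k \<in> I" "j \<in> I" "k \<noteq> j" "0 < N" "M (\<bar>a\<bar> / N) + M (\<bar>b\<bar> / N) \<le> 1"
  shows "luxemburg_norm M I (\<lambda>i. a * basic_vector k i + b * basic_vector j i) \<le> ennreal N"
  using assms by (intro luxemburg_norm_leI[OF _ _ has_sum_two_point]) auto

lemma norm_basic_vector:
  assumes "k \<in> I"
  shows "luxemburg_norm M I (basic_vector k) = 1"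
proof (rule antisym)
  have hs: "((\<lambda>i. M (\<bar>basic_vector k i\<bar> / N)) has_sum M (1 / N)) I" if "0 < N" for N
    using assms that by (intro has_sum_finite_neutralI[of "{k}"]) (auto simp: basic_vector_def zero)
  then show "luxemburg_norm M I (basic_vector k) \<le> 1"
    using luxemburg_norm_leI[of 1 1 "basic_vector k" I] hs[of 1] one by simp
  show "1 \<le> luxemburg_norm M I (basic_vector k)"
    unfolding luxemburg_norm_def
  proof (intro Inf_greatest, clarify)
    fix r :: real assume r: "0 < r" and le: "(\<Sum>\<^sub>\<infinity>i\<in>I. ennreal (M (\<bar>basic_vector k i\<bar> / r))) \<le> 1"
    obtain s where "s \<le> 1" "((\<lambda>i. M (\<bar>basic_vector k i\<bar> / r)) has_sum s) I"
      using le r by (subst (asm) infsum_ennreal_le_one_iff) (auto intro: nonneg)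
    then have "M (1 / r) \<le> 1"
      using hs[OF r] has_sum_unique by blast
    then have "1 \<le> r"
      using le_one_iff[of "1 / r"] r by simp
    then show "1 \<le> ennreal r"
      using ennreal_leI by fastforce
  qed
qed

section \<open>Images of basic vectors have disjoint supports\<close>

text \<open>
  This is midpoint convexity of \<open>x \<mapsto> M (\<bar>x\<bar> / N)\<close> on the whole line: every coordinate contributes a
  nonnegative second difference.
\<close>

lemma midpoint: "2 * M (\<bar>u\<bar> / N) \<le> M (\<bar>u + v\<bar> / N) + M (\<bar>u - v\<bar> / N)" if "0 < N"
proof -
  have "M (\<bar>u\<bar> / N) \<le> M ((1 - 1/2) *\<^sub>R (\<bar>u + v\<bar> / N) + (1/2) *\<^sub>R (\<bar>u - v\<bar> / N))"
    using that by (intro mono_nonneg) (auto simp: field_simps)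
  also have "\<dots> \<le> (1 - 1/2) * M (\<bar>u + v\<bar> / N) + 1/2 * M (\<bar>u - v\<bar> / N)"
    using that by (intro convex_onD[OF convex]) auto
  finally show ?thesis by simp
qed

text \<open>
  The norm bound says that moving from \<open>f\<close> in the directions \<open>\<plusminus>g\<close> costs as little as for disjointly
  supported vectors, namely \<open>O(M t) = o(t\<^sup>2)\<close>, whereas a common coordinate would cost at least a multiple
  of \<open>t\<^sup>2\<close>.
\<close>

lemma disjoint_supports:
  assumes f: "((\<lambda>i. M \<bar>f i\<bar>) has_sum 1) UNIV"
    and norm: "\<And>t. luxemburg_norm M UNIV (\<lambda>i. f i + t * g i) \<le> ennreal (1 + M \<bar>t\<bar>)"
    and curved: "\<And>a. 0 < a \<Longrightarrow> \<exists>c>0. \<forall>y h. 0 \<le> h \<and> a \<le> y - h \<longrightarrow> 2 * M y + c * h\<^sup>2 \<le> M (y + h) + M (y - h)"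
    and small: "\<And>e. 0 < e \<Longrightarrow> \<forall>\<^sub>F t in at_right 0. M t \<le> e * t\<^sup>2"
  shows "f i * g i = 0"
proof (rule ccontr)
  assume "f i * g i \<noteq> 0"
  define a b where "a = \<bar>f i\<bar>" and "b = \<bar>g i\<bar>"
  have ab: "0 < a" "0 < b"
    using \<open>f i * g i \<noteq> 0\<close> by (auto simp: a_def b_def)
  obtain c where c: "0 < c"
      "\<And>y h. 0 \<le> h \<Longrightarrow> a / 4 \<le> y - h \<Longrightarrow> 2 * M y + c * h\<^sup>2 \<le> M (y + h) + M (y - h)"
    using curved[of "a / 4"] ab by auto
  \<comment> \<open>The summation below yields \<open>c * b\<^sup>2 * t\<^sup>2 \<le> 8 * C * M t\<close>; this \<open>e\<close> makes \<open>M t \<le> e * t\<^sup>2\<close> contradict it.\<close>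
  define e where "e = c * b\<^sup>2 / 16 / (C + 1)"
  have "e * (C + 1) = c * b\<^sup>2 / 16"
    unfolding e_def using C_nonneg by (intro nonzero_eq_divide_eq[THEN iffD1]) auto
  then have e_eq: "16 * (C * e) + 16 * e = c * b\<^sup>2"
    by (simp add: algebra_simps)
  have e: "0 < e"
    using c(1) ab C_nonneg by (simp add: e_def)
  have "\<forall>\<^sub>F t in at_right 0. t \<in> {0<..<min 1 (a / (2 * b))}"
    using ab by (intro eventually_at_right_real) simp
  with small[OF e] have "\<forall>\<^sub>F t in at_right 0. M t \<le> e * t\<^sup>2 \<and> t \<in> {0<..<min 1 (a / (2 * b))}"
    by (rule eventually_conj)
  then obtain t where t: "M t \<le> e * t\<^sup>2" "t < 1" "t < a / (2 * b)" "0 < t"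
    using eventually_happens'[OF trivial_limit_at_right_real] by fastforce
  have tb: "t * b < a / 2"
    using t(3) ab by (simp add: field_simps)
  define N where "N = 1 + M t"
  have N: "1 \<le> N" "N \<le> 2"
    using le_one_iff[of t] nonneg[of t] t by (auto simp: N_def)
  obtain p where p: "p \<le> 1" "((\<lambda>i. M (\<bar>f i + t * g i\<bar> / N)) has_sum p) UNIV"
    using luxemburg_norm_leD[of N UNIV "\<lambda>i. f i + t * g i"] norm[of t] N t by (auto simp: N_def)
  obtain q where q: "q \<le> 1" "((\<lambda>i. M (\<bar>f i - t * g i\<bar> / N)) has_sum q) UNIV"
    using luxemburg_norm_leD[of N UNIV "\<lambda>i. f i - t * g i"] norm[of "- t"] N t by (auto simp: N_def)
  \<comment> \<open>The gain beyond convexity, collected at the coordinate \<open>i\<close> alone.\<close>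
  let ?\<eta> = "\<lambda>k. if k = i then c * (t * b / N)\<^sup>2 else 0"
  have lower: "((\<lambda>k. 2 * ((1 - C * (1 - 1 / N)) * M \<bar>f k\<bar>) + ?\<eta> k) has_sum
      (2 * ((1 - C * (1 - 1 / N)) * 1) + c * (t * b / N)\<^sup>2)) UNIV"
    by (intro has_sum_add has_sum_cmult_right f has_sum_finite_neutralI[of "{i}"]) auto
  have le: "2 * ((1 - C * (1 - 1 / N)) * M \<bar>f k\<bar>) + ?\<eta> k
      \<le> M (\<bar>f k + t * g k\<bar> / N) + M (\<bar>f k - t * g k\<bar> / N)" for k
  proof -
    have "(1 - C * (1 - 1 / N)) * M \<bar>f k\<bar> \<le> M (\<bar>f k\<bar> / N)"
      using doubling[of "\<bar>f k\<bar>" "1 / N"] le_one_of_modular[OF f, of k] N by simp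
    moreover have "2 * M (\<bar>f k\<bar> / N) + ?\<eta> k \<le> M (\<bar>f k + t * g k\<bar> / N) + M (\<bar>f k - t * g k\<bar> / N)"
    proof (cases "k = i")
      case True
      have "(a + t * b) / N = \<bar>f i + t * g i\<bar> / N \<and> (a - t * b) / N = \<bar>f i - t * g i\<bar> / N \<or>
            (a + t * b) / N = \<bar>f i - t * g i\<bar> / N \<and> (a - t * b) / N = \<bar>f i + t * g i\<bar> / N"
      proof -
        have "t * b = \<bar>t * g i\<bar>"
          using t(4) by (simp add: b_def abs_mult)
        then have "a + t * b = \<bar>f i + t * g i\<bar> \<and> a - t * b = \<bar>f i - t * g i\<bar> \<or>
            a + t * b = \<bar>f i - t * g i\<bar> \<and> a - t * b = \<bar>f i + t * g i\<bar>"
          using tb ab unfolding a_def by linarith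
        then show ?thesis by metis
      qed
      \<comment> \<open>Since \<open>N \<le> 2\<close> and \<open>t * b < a / 2\<close>, the three points stay above \<open>a / 4\<close>.\<close>
      moreover have "2 * M (a / N) + c * (t * b / N)\<^sup>2 \<le> M (a / N + t * b / N) + M (a / N - t * b / N)"
      proof (rule c(2))
        show "0 \<le> t * b / N"
          using t ab N by simp
        have "a / 4 * N \<le> a / 4 * 2"
          using N ab by (intro mult_left_mono) auto
        also have "\<dots> \<le> a - t * b"
          using tb by simp
        finally show "a / 4 \<le> a / N - t * b / N"
          using N by (simp add: field_simps)
      qed
      ultimately show ?thesis
        using True unfolding a_def[symmetric]
        by (auto simp: add_divide_distrib[symmetric] diff_divide_distrib[symmetric] a_def[symmetric])
    qed (use midpoint N in auto)
    ultimately show ?thesis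
      by linarith
  qed
  have "2 * ((1 - C * (1 - 1 / N)) * 1) + c * (t * b / N)\<^sup>2 \<le> p + q"
    by (rule has_sum_mono[OF lower has_sum_add[OF p(2) q(2)] le])
  then have "c * (t * b / N)\<^sup>2 \<le> 2 * (C * (1 - 1 / N))"
    using p(1) q(1) by (simp add: algebra_simps)
  also have "1 - 1 / N \<le> M t"
    using N nonneg[of t] t by (simp add: N_def field_simps)
  then have "C * (1 - 1 / N) \<le> C * (e * t\<^sup>2)"
    using t(1) C_nonneg by (intro mult_left_mono) auto
  finally have "c * (t * b / N)\<^sup>2 \<le> 2 * (C * (e * t\<^sup>2))"
    by simp
  moreover have "c * (t * b / 2)\<^sup>2 \<le> c * (t * b / N)\<^sup>2"
    using N t ab c by (intro mult_left_mono power_mono divide_left_mono) auto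
  moreover have "(c * b\<^sup>2) * t\<^sup>2 = 4 * (c * (t * b / 2)\<^sup>2)"
    by (simp add: power_mult_distrib power_divide)
  ultimately have "(c * b\<^sup>2) * t\<^sup>2 \<le> 8 * (C * (e * t\<^sup>2))"
    by linarith
  then have "(c * b\<^sup>2) * t\<^sup>2 \<le> (8 * (C * e)) * t\<^sup>2"
    by (simp only: mult.assoc)
  then have "c * b\<^sup>2 \<le> 8 * (C * e)"
    using t(4) by simp
  moreover have "0 \<le> C * e"
    using C_nonneg e by simp
  ultimately show False
    using e e_eq by linarith
qed

section \<open>Norm-one images are supported at one coordinate\<close>

text \<open>
  The modular of \<open>v (f + g)\<close> is at most \<open>1\<close> by the norm bound and at least \<open>1\<close> by
  supermultiplicativity, and the latter bound is strict as soon as some \<open>\<bar>f i\<bar>\<close> lies strictly between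
  \<open>0\<close> and \<open>1\<close>.
\<close>

lemma single_support:
  assumes f: "((\<lambda>i. M \<bar>f i\<bar>) has_sum 1) UNIV" and g: "((\<lambda>i. M \<bar>g i\<bar>) has_sum 1) UNIV"
    and disj: "\<And>i. f i * g i = 0"
    and v: "0 < v" "v < 1" "M v = 1 / 2"
    and norm: "luxemburg_norm M UNIV (\<lambda>i. f i + g i) \<le> ennreal (1 / v)"
    and supermult: "\<And>s. 0 < s \<Longrightarrow> s < 1 \<Longrightarrow> M v * M s < M (v * s)"
  shows "\<exists>c j. f = (\<lambda>i. c * basic_vector j i)"
proof -
  have half: "M s / 2 \<le> M (v * s)" if "0 \<le> s" "s \<le> 1" for s
  proof -
    consider "s = 0" | "0 < s" "s < 1" | "s = 1"
      using \<open>0 \<le> s\<close> \<open>s \<le> 1\<close> by fastforce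
    then show ?thesis
      using supermult[of s] v(3) zero one by cases auto
  qed
  note f1 = le_one_of_modular[OF f order_refl UNIV_I] and g1 = le_one_of_modular[OF g order_refl UNIV_I]
  obtain p where p: "p \<le> 1" "((\<lambda>i. M (\<bar>f i + g i\<bar> / (1 / v))) has_sum p) UNIV"
    using luxemburg_norm_leD[OF _ norm] v by auto
  have split: "M (\<bar>f i + g i\<bar> / (1 / v)) = M (v * \<bar>f i\<bar>) + M (v * \<bar>g i\<bar>)" for i
    using disj[of i] by (auto simp: zero mult.commute)
  have sum1: "((\<lambda>i. M \<bar>f i\<bar> / 2 + M \<bar>g i\<bar> / 2) has_sum 1) UNIV"
    using has_sum_add[OF has_sum_cmult_right[OF f, of "1/2"] has_sum_cmult_right[OF g, of "1/2"]] by simp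
  have f01: "\<bar>f i\<bar> = 1" if "f i \<noteq> 0" for i
  proof (rule ccontr)
    assume "\<bar>f i\<bar> \<noteq> 1"
    then have "M \<bar>f i\<bar> / 2 < M (v * \<bar>f i\<bar>)"
      using supermult[of "\<bar>f i\<bar>"] f1[of i] that v(3) by simp
    then have "M \<bar>f i\<bar> / 2 + M \<bar>g i\<bar> / 2 < M (\<bar>f i + g i\<bar> / (1 / v))"
      unfolding split using g1 by (intro add_less_le_mono half) auto
    moreover have "M \<bar>f k\<bar> / 2 + M \<bar>g k\<bar> / 2 \<le> M (\<bar>f k + g k\<bar> / (1 / v))" for k
      unfolding split using f1 g1 by (intro add_mono half) auto
    ultimately have "1 < p"
      by (intro has_sum_strict_mono[OF sum1 p(2), of i]) auto
    then show False
      using p(1) by simp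
  qed
  obtain j where j: "f j \<noteq> 0"
  proof (rule ccontr)
    assume *: "\<not> thesis"
    have "f = (\<lambda>_. 0)"
      using * that by auto
    then show False
      using infsumI[OF f] zero by simp
  qed
  have "f i = 0" if "i \<noteq> j" for i
  proof (rule ccontr)
    assume "f i \<noteq> 0"
    moreover have "(\<Sum>k\<in>{i, j}. M \<bar>f k\<bar>) \<le> 1"
      using f by (intro finite_sum_le_has_sum[where A = UNIV]) (auto intro: nonneg)
    ultimately show False
      using j f01 that one by simp
  qed
  then have "f = (\<lambda>i. f j * basic_vector j i)"
    by (auto simp: basic_vector_def fun_eq_iff)
  then show ?thesis by blast
qed

end

section \<open>Curvature of the Orlicz function\<close>

lemma convex_above_tangent:
  fixes f :: "real \<Rightarrow> real"
  assumes "convex_on {0..} f" "(f has_real_derivative D) (at x)" "0 < x" "0 \<le> y"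
  shows "D * (y - x) \<le> f y - f x"
proof (rule convex_on_imp_above_tangent[OF assms(1)])
  show "(f has_real_derivative D) (at x within {0..})"
    using assms(2) by (rule has_field_derivative_at_within)
qed (use assms in auto)

text \<open>
  The functions \<open>f1\<close>, \<open>f2\<close>, \<open>f3\<close> are the successive derivatives of \<open>f\<close> on the open half-line; the
  behaviour at \<open>0\<close> enters through convexity on the closed half-line and through \<open>f t = o(t\<^sup>2)\<close>.
\<close>

locale convex_flat_at_zero =
  fixes f f1 f2 f3 :: "real \<Rightarrow> real"
  assumes f1: "\<And>x. 0 < x \<Longrightarrow> (f has_real_derivative f1 x) (at x)"
    and f2: "\<And>x. 0 < x \<Longrightarrow> (f1 has_real_derivative f2 x) (at x)"
    and f3: "\<And>x. 0 < x \<Longrightarrow> (f2 has_real_derivative f3 x) (at x)"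
    and mono_f3: "\<And>x y. 0 < x \<Longrightarrow> x \<le> y \<Longrightarrow> f3 x \<le> f3 y"
    and cvx: "convex_on {0..} f"
    and f_pos: "\<And>x. 0 < x \<Longrightarrow> 0 < f x"
    and small: "\<And>e. 0 < e \<Longrightarrow> \<forall>\<^sub>F t in at_right 0. f t \<le> e * t\<^sup>2"
begin

lemma above_tangent: "f1 x * (y - x) \<le> f y - f x" if "0 < x" "0 \<le> y"
  using cvx f1[OF that(1)] that by (rule convex_above_tangent)

lemma f2_nonneg: "0 \<le> f2 x" if "0 < x"
proof (rule mono_on_imp_deriv_nonneg[where A = "{0<..}"])
  show "mono_on {0<..} f1"
  proof (rule mono_onI)
    fix x y :: real assume xy: "x \<in> {0<..}" "y \<in> {0<..}" "x \<le> y"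
    have "f1 x * (y - x) \<le> f1 y * (y - x)"
      using above_tangent[of x y] above_tangent[of y x] xy by (simp add: algebra_simps)
    then show "f1 x \<le> f1 y"
      using xy by (cases "x = y") auto
  qed
qed (use that f2 in \<open>auto simp: interior_open\<close>)

text \<open>If \<open>f2 \<ge> c\<close>, then \<open>f x - c / 2 * x\<^sup>2\<close> is convex; this is its midpoint inequality.\<close>

lemma second_difference_ge:
  assumes "\<And>x. l \<le> x \<Longrightarrow> x \<le> u \<Longrightarrow> c \<le> f2 x" "0 < l" "l \<le> y - h" "y + h \<le> u" "0 \<le> h"
  shows "2 * f y + c * h\<^sup>2 \<le> f (y + h) + f (y - h)"
proof -
  have "convex_on {l..u} (\<lambda>x. f x - c / 2 * x\<^sup>2)"
    using assms by (intro f''_ge0_imp_convex[where f' = "\<lambda>x. f1 x - c * x" and f'' = "\<lambda>x. f2 x - c"])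
      (auto intro!: derivative_eq_intros f1 f2)
  from convex_onD[OF this, of "1/2" "y - h" "y + h"] assms
  show ?thesis
    by (simp add: field_simps power2_eq_square)
qed

text \<open>
  As \<open>f3\<close> is nondecreasing, \<open>f3 s < 0\<close> would make \<open>f2\<close> decrease at a definite rate on \<open>(0, s]\<close>, so \<open>f2\<close>
  would be bounded below near \<open>0\<close> by some \<open>k > 0\<close>, and second differences near \<open>0\<close> would contradict
  \<open>f t = o(t\<^sup>2)\<close>.
\<close>

lemma f3_nonneg: "0 \<le> f3 s" if s: "0 < s"
proof (rule ccontr)
  assume neg: "\<not> 0 \<le> f3 s"
  define k where "k = - f3 s * s / 2"
  have k: "0 < k"
    using neg s by (simp add: k_def mult_neg_pos)
  have lower: "k \<le> f2 x" if x: "0 < x" "x \<le> s / 2" for x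
  proof -
    have "\<exists>z. x < z \<and> z < s \<and> f2 s - f2 x = (s - x) * f3 z"
      using x s by (intro MVT2) (auto intro: f3)
    then obtain z where z: "x < z" "z < s" "f2 s - f2 x = (s - x) * f3 z"
      by blast
    have "(s - x) * f3 z \<le> (s - x) * f3 s"
      using x z by (intro mult_left_mono mono_f3) auto
    also have "\<dots> \<le> s / 2 * f3 s"
      using x neg by (intro mult_right_mono_neg) auto
    finally show ?thesis
      using z f2_nonneg[OF s] by (simp add: k_def algebra_simps)
  qed
  have "\<forall>\<^sub>F t in at_right 0. f t \<le> k / 40 * t\<^sup>2"
    using k by (intro small) auto
  then obtain d where d: "0 < d" "\<And>t. 0 < t \<Longrightarrow> t < d \<Longrightarrow> f t \<le> k / 40 * t\<^sup>2"
    by (auto simp: eventually_at_right_field)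
  \<comment> \<open>The points \<open>2 * h\<close>, \<open>3 * h\<close>, \<open>4 * h\<close> lie in the range of both bounds, and
    \<open>(4\<^sup>2 + 2\<^sup>2) * (k / 40) = k / 2 < k\<close>.\<close>
  define h where "h = min d (s / 2) / 8"
  have h: "0 < h" "4 * h < d" "4 * h \<le> s / 2"
    using d s by (auto simp: h_def)
  have "2 * f (3 * h) + k * h\<^sup>2 \<le> f (3 * h + h) + f (3 * h - h)"
    using h lower by (intro second_difference_ge[of "2 * h" "s / 2"]) auto
  also have "\<dots> \<le> k / 40 * (4 * h)\<^sup>2 + k / 40 * (2 * h)\<^sup>2"
    using d(2)[of "4 * h"] d(2)[of "2 * h"] h by simp
  also have "\<dots> = k / 2 * h\<^sup>2"
    by (simp add: power_mult_distrib)
  finally have "k * h\<^sup>2 \<le> k / 2 * h\<^sup>2"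
    using f_pos[of "3 * h"] h by simp
  then show False
    using k h by simp
qed

lemma f2_mono: "f2 x \<le> f2 y" if "0 < x" "x \<le> y"
proof (rule DERIV_nonneg_imp_nondecreasing[OF that(2)])
  fix z assume "x \<le> z" "z \<le> y"
  with that(1) have "0 < z" by simp
  then show "\<exists>d. (f2 has_real_derivative d) (at z) \<and> 0 \<le> d"
    using f3 f3_nonneg by blast
qed

text \<open>
  Being nonnegative and nondecreasing, \<open>f2\<close> vanishes on \<open>(0, b]\<close> as soon as it vanishes at \<open>b\<close>.  Then \<open>f\<close> is
  affine near \<open>0\<close>, and flatness at \<open>0\<close> leaves only the zero function.
\<close>

lemma f2_pos: "0 < f2 b" if b: "0 < b"
proof (rule ccontr)
  assume "\<not> 0 < f2 b"
  then have f2_0: "f2 x = 0" if "0 < x" "x \<le> b" for x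
    using f2_mono[of x b] f2_nonneg[of x] that by simp
  define m where "m = f1 (b / 2)"
  have f1_deriv: "(f1 has_real_derivative 0) (at x)" if "x \<in> {0<..<b}" for x
    using f2[of x] f2_0[of x] that by simp
  have "f1 x = m" if "x \<in> {0<..<b}" for x
    unfolding m_def by (rule DERIV_isconst3[OF b that _ f1_deriv]) (use b in auto)
  then have shift: "((\<lambda>x. f x - m * x) has_real_derivative 0) (at x)" if "x \<in> {0<..<b}" for x
    using that f1[of x] by (auto intro!: derivative_eq_intros)
  have "f x - m * x = f (b / 2) - m * (b / 2)" if "x \<in> {0<..<b}" for x
    by (rule DERIV_isconst3[OF b that _ shift]) (use b in auto)
  then obtain q where q: "\<And>x. x \<in> {0<..<b} \<Longrightarrow> f x = m * x + q"
    by (metis add.commute diff_eq_eq)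
  have near: "\<forall>\<^sub>F x in at_right 0. x \<in> {0<..<b} \<and> f x \<le> x\<^sup>2"
    using b small[of 1] by (intro eventually_conj eventually_at_right_real) auto
  have "((\<lambda>x. m * x + q) \<longlongrightarrow> m * 0 + q) (at_right 0)"
    by (intro tendsto_intros)
  moreover have "\<forall>\<^sub>F x in at_right 0. 0 \<le> m * x + q"
    using near by eventually_elim (metis f_pos greaterThanLessThan_iff less_imp_le q)
  ultimately have "0 \<le> q"
    using tendsto_lowerbound[of "\<lambda>x. m * x + q" "m * 0 + q" "at_right 0" 0] by simp
  have "\<forall>\<^sub>F x in at_right 0. m \<le> x"
    using near
  proof eventually_elim
    case (elim x)
    have "m * x \<le> x * x"
      using elim q[of x] \<open>0 \<le> q\<close> unfolding power2_eq_square by linarith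
    moreover have "0 < x"
      using elim by simp
    ultimately show ?case
      by (rule mult_right_le_imp_le)
  qed
  then have "m \<le> 0"
    using tendsto_lowerbound[OF tendsto_ident_at, of m 0 "{0<..}"] by simp
  have "\<forall>\<^sub>F x in at_right 0. q \<le> x\<^sup>2 - m * x"
    using near by eventually_elim (auto simp: q)
  moreover have "((\<lambda>x. x\<^sup>2 - m * x) \<longlongrightarrow> 0\<^sup>2 - m * 0) (at_right 0)"
    by (intro tendsto_intros)
  ultimately have "q \<le> 0"
    using tendsto_lowerbound[of "\<lambda>x. x\<^sup>2 - m * x" "0\<^sup>2 - m * 0" "at_right 0" q] by simp
  moreover have "m * (b / 2) \<le> 0"
    using b \<open>m \<le> 0\<close> by (intro mult_nonpos_nonneg) auto
  ultimately have "f (b / 2) \<le> 0"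
    using q[of "b / 2"] b by simp
  then show False
    using f_pos[of "b / 2"] b by simp
qed

lemma uniformly_curved: "\<exists>c>0. \<forall>y h. 0 \<le> h \<and> a \<le> y - h \<longrightarrow> 2 * f y + c * h\<^sup>2 \<le> f (y + h) + f (y - h)"
  if "0 < a"
proof (intro exI conjI allI impI)
  show "0 < f2 a"
    using that by (rule f2_pos)
  show "2 * f y + f2 a * h\<^sup>2 \<le> f (y + h) + f (y - h)" if "0 \<le> h \<and> a \<le> y - h" for y h
    using that \<open>0 < a\<close> f2_mono[of a] by (intro second_difference_ge[of a "y + h"]) auto
qed

end

section \<open>From the hypotheses to the analytic facts\<close>

text \<open>
  By continuity at \<open>1\<close> there is \<open>b < 1\<close> with \<open>M b > 0\<close>; supermultiplicativity then gives \<open>M (b ^ n) > 0\<close> for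
  all \<open>n \<ge> 1\<close>, and these points tend to \<open>0\<close>.  Strict supermultiplicativity is assumed only where \<open>M\<close> is
  positive, because a factor \<open>\<alpha> > 1\<close> gives a strict inequality only there.
\<close>

lemma supermultiplicative_imp_pos:
  fixes M :: "real \<Rightarrow> real"
  assumes orlicz: "orlicz_function M" and cont: "continuous_on {0..} M" and one: "M 1 = 1"
    and super: "\<And>t u. 0 < t \<Longrightarrow> t < 1 \<Longrightarrow> 0 < u \<Longrightarrow> u < 1 \<Longrightarrow> 0 < M t \<Longrightarrow> 0 < M u \<Longrightarrow> M t * M u < M (t * u)"
    and t: "0 < t"
  shows "0 < M t"
proof -
  have nonneg: "0 \<le> M x" if "0 \<le> x" for x
    using orlicz that by (simp add: orlicz_function_def)
  have shrink: "M (l * x) \<le> l * M x" if "0 \<le> l" "l \<le> 1" "0 \<le> x" for l x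
    using orlicz convex_onD[of "{0..}" M l 0 x] that by (auto simp: orlicz_function_def)
  obtain b where b: "0 < b" "b < 1" "0 < M b"
  proof -
    have "(M \<longlongrightarrow> M 1) (at_left 1)"
    proof (rule continuous_on_tendsto_compose[OF cont])
      show "((\<lambda>x. x) \<longlongrightarrow> 1) (at_left (1::real))" by (rule tendsto_ident_at)
      show "\<forall>\<^sub>F x in at_left (1::real). x \<in> {0..}"
        using eventually_at_left_real[of 0 "1::real"] by (auto elim: eventually_mono)
    qed auto
    then have "\<forall>\<^sub>F x in at_left 1. 0 < M x"
      using one by (intro order_tendstoD(1)) auto
    moreover have "\<forall>\<^sub>F x in at_left 1. x \<in> {0<..<1::real}"
      by (rule eventually_at_left_real) simp
    ultimately have "\<forall>\<^sub>F x in at_left 1. 0 < M x \<and> x \<in> {0<..<1::real}"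
      by (rule eventually_conj)
    then show ?thesis
      using that eventually_happens'[of "at_left (1::real)"] by auto
  qed
  have "0 < M (b ^ Suc n)" for n
  proof (induction n)
    case (Suc n)
    have "0 < M b * M (b ^ Suc n)"
      using b Suc by simp
    also have "\<dots> < M (b * b ^ Suc n)"
      using b Suc by (intro super) (auto simp: power_Suc_less_one simp del: power_Suc)
    finally show ?case by simp
  qed (use b in simp)
  moreover obtain n where "b ^ n < t"
    using real_arch_pow_inv t b by blast
  then have n: "b ^ Suc n < t"
    using b power_decreasing[of n "Suc n" b] by linarith
  ultimately have "0 < M (b ^ Suc n / t * t)"
    using t by (simp del: power_Suc)
  also have "\<dots> \<le> b ^ Suc n / t * M t"
    using b n t by (intro shrink) (auto simp del: power_Suc)
  finally show ?thesis
    using t nonneg[of t] by (cases "M t = 0") simp_all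
qed

text \<open>
  Near \<open>0\<close> the elasticity \<open>s * M' s / M s\<close> is bounded by assumption.  On \<open>[d, 2]\<close> the tangent at \<open>s\<close>
  evaluated at \<open>2 * s\<close> gives \<open>s * M' s \<le> M 4\<close>, while \<open>M s \<ge> M d > 0\<close>.  The tangent at \<open>s\<close> evaluated at
  \<open>l * s\<close> then yields the claim.
\<close>

lemma elasticity_imp_doubling:
  assumes orlicz: "orlicz_function M" and pos: "\<And>t. 0 < t \<Longrightarrow> 0 < M t"
    and deriv: "\<And>t. 0 < t \<Longrightarrow> (M has_real_derivative M' t) (at t)"
    and elasticity: "Limsup (at_right 0) (\<lambda>t. ereal (t * M' t / M t)) < \<infinity>"
  shows "\<exists>C\<ge>0. \<forall>s l. 0 \<le> s \<and> s \<le> 2 \<and> 0 \<le> l \<and> l \<le> 1 \<longrightarrow> (1 - C * (1 - l)) * M s \<le> M (l * s)"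
proof -
  have cvx: "convex_on {0..} M" and zero: "M 0 = 0" and nonneg: "\<And>t. 0 \<le> t \<Longrightarrow> 0 \<le> M t"
    using orlicz by (auto simp: orlicz_function_def)
  have tangent: "M' x * (y - x) \<le> M y - M x" if "0 < x" "0 \<le> y" for x y
    using cvx deriv[OF that(1)] that by (rule convex_above_tangent)
  have mono: "M s \<le> M t" if "0 < s" "s \<le> t" for s t
  proof -
    have "M (s / t * t) \<le> s / t * M t"
      using convex_onD[OF cvx, of "s / t" 0 t] that zero by simp
    also have "\<dots> \<le> 1 * M t"
      using that nonneg by (intro mult_right_mono) auto
    finally show ?thesis using that by simp
  qed
  obtain K where "Limsup (at_right 0) (\<lambda>t. ereal (t * M' t / M t)) < ereal K"
    using ereal_dense2[OF elasticity] by blast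
  then have "\<forall>\<^sub>F t in at_right 0. t * M' t / M t < K"
    by (auto dest: Limsup_lessD)
  then obtain d where d: "0 < d" "\<And>t. 0 < t \<Longrightarrow> t < d \<Longrightarrow> t * M' t / M t < K"
    by (auto simp: eventually_at_right_field)
  define C where "C = max K (M 4 / M d)"
  have C: "0 \<le> C" "K \<le> C" "M 4 / M d \<le> C"
    using nonneg[of 4] nonneg[of d] d(1) by (auto simp: C_def le_max_iff_disj)
  have bound: "s * M' s \<le> C * M s" if s: "0 < s" "s \<le> 2" for s
  proof (cases "s < d")
    case True
    then have "s * M' s \<le> K * M s"
      using d(2)[of s] s pos[of s] by (simp add: field_simps)
    also have "\<dots> \<le> C * M s"
      using C nonneg[of s] s by (intro mult_right_mono) auto
    finally show ?thesis .
  next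
    case False
    have "s * M' s \<le> M (2 * s) - M s"
      using tangent[of s "2 * s"] s by (simp add: mult.commute)
    also have "\<dots> \<le> M 4"
      using mono[of "2 * s" 4] nonneg[of s] s by simp
    also have "\<dots> \<le> C * M d"
      using C(3) pos[OF d(1)] by (simp add: field_simps)
    also have "\<dots> \<le> C * M s"
      using C(1) False d(1) mono[of d s] by (intro mult_left_mono) auto
    finally show ?thesis .
  qed
  have "(1 - C * (1 - l)) * M s \<le> M (l * s)" if "0 \<le> s" "s \<le> 2" "0 \<le> l" "l \<le> 1" for s l
  proof (cases "s = 0")
    case False
    have "(1 - l) * (s * M' s) \<le> (1 - l) * (C * M s)"
      using that False bound[of s] by (intro mult_left_mono) auto
    moreover have "M' s * (l * s - s) \<le> M (l * s) - M s"
      using that False by (intro tangent) auto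
    ultimately show ?thesis
      by (simp add: algebra_simps)
  qed (simp add: zero)
  then show ?thesis
    using C(1) by blast
qed

lemma deriv_nonneg_has_derivative:
  assumes "C3_nonneg M" "i < 3" "0 < t"
  shows "(deriv_nonneg i M has_real_derivative deriv_nonneg (Suc i) M t) (at t)"
proof -
  have "deriv_nonneg i M differentiable (at t within {0..})"
    using assms by (auto simp: C3_nonneg_def differentiable_on_def)
  then have "(deriv_nonneg i M has_vector_derivative deriv_nonneg (Suc i) M t) (at t within {0..})"
    by (simp add: vector_derivative_works)
  moreover have "at t within {0..} = at t"
    using assms by (intro at_within_interior) auto
  ultimately show ?thesis
    by (simp add: has_real_derivative_iff_has_vector_derivative)
qed

section \<open>Rigidity of isometric embeddings\<close>

theorem corollary1p9:
  fixes M :: "real \<Rightarrow> real" and I :: "nat set" and T :: "(nat \<Rightarrow> real) \<Rightarrow> (nat \<Rightarrow> real)"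
  assumes "orlicz_function M"
    and "C3_nonneg M"
    and "mono_on {0..} (deriv_nonneg 3 M)"
    and "M \<in> o[at_right 0](\<lambda>t. t ^ 3)"
    and "Delta2pp M"
    and "M 1 = 1"
    and "\<forall>\<epsilon>>0. \<exists>\<alpha>>1. \<forall>t u. 0 < t \<and> t \<le> 1 - \<epsilon> \<and> 0 < u \<and> u \<le> 1 - \<epsilon> \<longrightarrow>
           M (t * u) \<ge> \<alpha> * M t * M u"
    and "I = UNIV \<or> (\<exists>n. n \<noteq> 1 \<and> I = {1..n})"
    and "linear_isometric_embedding M I T"
  shows "\<forall>k\<in>I. \<exists>c j. T (basic_vector k) = (\<lambda>i. c * basic_vector j i)"
proof
  fix k assume k: "k \<in> I"
  note deriv = deriv_nonneg_has_derivative[OF assms(2)]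
  have super: "M t * M u < M (t * u)" if "0 < t" "t < 1" "0 < u" "u < 1" "0 < M t" "0 < M u" for t u
  proof -
    have "0 < 1 - max t u"
      using that by simp
    then obtain \<alpha> where \<alpha>: "1 < \<alpha>"
        "\<forall>t' u'. 0 < t' \<and> t' \<le> 1 - (1 - max t u) \<and> 0 < u' \<and> u' \<le> 1 - (1 - max t u) \<longrightarrow>
          \<alpha> * M t' * M u' \<le> M (t' * u')"
      using assms(7) by blast
    have "1 * (M t * M u) < \<alpha> * (M t * M u)"
      using \<alpha>(1) that by (intro mult_strict_right_mono) auto
    also have "\<dots> \<le> M (t * u)"
      using \<alpha>(2)[rule_format, of t u] that by (simp add: mult.assoc)
    finally show ?thesis by simp
  qed
  have cont: "continuous_on {0..} M"
    using assms(2) by (auto simp: C3_nonneg_def intro!: differentiable_imp_continuous_on dest!: spec[of _ 0])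
  have pos: "0 < M t" if "0 < t" for t
    using super that by (rule supermultiplicative_imp_pos[OF assms(1) cont assms(6)])
  have deriv1: "(M has_real_derivative deriv_nonneg 1 M x) (at x)" if "0 < x" for x
    using deriv[of 0 x] that by simp
  have elasticity: "Limsup (at_right 0) (\<lambda>t. ereal (t * deriv_nonneg 1 M t / M t)) < \<infinity>"
    using assms(5)[unfolded Delta2pp_def, THEN bspec, of 1] by simp
  obtain C where "0 \<le> C" "\<And>s l. 0 \<le> s \<Longrightarrow> s \<le> 2 \<Longrightarrow> 0 \<le> l \<Longrightarrow> l \<le> 1 \<Longrightarrow> (1 - C * (1 - l)) * M s \<le> M (l * s)"
    using elasticity_imp_doubling[OF assms(1) pos deriv1 elasticity] by blast
  then interpret orlicz_doubling M C
    using assms(1,6) cont pos by unfold_locales auto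
  have small: "\<forall>\<^sub>F t in at_right 0. M t \<le> e * t\<^sup>2" if "0 < e" for e
    using landau_o.smallD[OF assms(4) that] eventually_at_right_real[of 0 1, OF zero_less_one]
  proof eventually_elim
    case (elim t)
    have "M t \<le> e * t ^ 3"
      using elim by (auto simp: abs_if split: if_splits)
    also have "\<dots> \<le> e * t\<^sup>2"
      using elim that by (intro mult_left_mono power_decreasing) auto
    finally show ?case .
  qed
  interpret flat: convex_flat_at_zero M "deriv_nonneg 1 M" "deriv_nonneg 2 M" "deriv_nonneg 3 M"
  proof
    show "(M has_real_derivative deriv_nonneg 1 M x) (at x)" if "0 < x" for x
      using that by (rule deriv1)
    show "(deriv_nonneg 1 M has_real_derivative deriv_nonneg 2 M x) (at x)" if "0 < x" for x
      using deriv[of 1 x] that unfolding Suc_1 by simp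
    show "(deriv_nonneg 2 M has_real_derivative deriv_nonneg 3 M x) (at x)" if "0 < x" for x
      using deriv[of 2 x] that unfolding numeral_3_eq_3 Suc_1[symmetric] One_nat_def by simp
    show "deriv_nonneg 3 M x \<le> deriv_nonneg 3 M y" if "0 < x" "x \<le> y" for x y
      using assms(3) that by (auto intro: mono_onD)
  qed (use convex pos small in auto)

  obtain j where j: "j \<in> I" "j \<noteq> k"
  proof -
    consider "I = UNIV" | n where "n \<noteq> 1" "I = {1..n}"
      using assms(8) by blast
    then show ?thesis
    proof cases
      case 1
      then show ?thesis using that[of "Suc k"] by simp
    next
      case 2
      then show ?thesis using that[of "if k = 1 then 2 else 1"] k by auto
    qed
  qed
  define f g where "f = T (basic_vector k)" and "g = T (basic_vector j)"
  have in_space: "(\<lambda>i. a * basic_vector k i + b * basic_vector j i) \<in> orlicz_space M I" for a b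
  proof -
    define N where "N = 1 + \<bar>a\<bar> + \<bar>b\<bar>"
    have "M (\<bar>a\<bar> / N) + M (\<bar>b\<bar> / N) \<le> \<bar>a\<bar> / N + \<bar>b\<bar> / N"
      using shrink[of "\<bar>a\<bar> / N" 1] shrink[of "\<bar>b\<bar> / N" 1] one by (auto simp: N_def)
    also have "\<dots> \<le> 1"
      unfolding add_divide_distrib[symmetric] by (simp add: N_def)
    finally have "luxemburg_norm M I (\<lambda>i. a * basic_vector k i + b * basic_vector j i) \<le> ennreal N"
      using k j by (intro two_point_norm_le) (auto simp: N_def)
    then have "luxemburg_norm M I (\<lambda>i. a * basic_vector k i + b * basic_vector j i) < \<infinity>"
      using le_less_trans by fastforce
    then show ?thesis
      using k j by (auto simp: orlicz_space_def basic_vector_def)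
  qed
  have basic: "basic_vector k \<in> orlicz_space M I" "basic_vector j \<in> orlicz_space M I"
    using in_space[of 1 0] in_space[of 0 1] by simp_all
  have T_add: "T (\<lambda>i. x i + y i) = (\<lambda>i. T x i + T y i)"
    if "x \<in> orlicz_space M I" "y \<in> orlicz_space M I" for x y
    using assms(9) that unfolding linear_isometric_embedding_def by simp
  have T_scale: "T (\<lambda>i. a * x i) = (\<lambda>i. a * T x i)" if "x \<in> orlicz_space M I" for a x
    using assms(9) that unfolding linear_isometric_embedding_def by simp
  have T_norm: "luxemburg_norm M UNIV (T x) = luxemburg_norm M I x" if "x \<in> orlicz_space M I" for x
    using assms(9) that unfolding linear_isometric_embedding_def by simp
  have T_comb: "T (\<lambda>i. 1 * basic_vector k i + t * basic_vector j i) = (\<lambda>i. f i + t * g i)" for t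
  proof -
    have "(\<lambda>i. t * basic_vector j i) \<in> orlicz_space M I"
      using in_space[of 0 t] by simp
    from T_add[OF basic(1) this] show ?thesis
      using T_scale[OF basic(2)] by (simp add: f_def g_def)
  qed
  have norm_comb: "luxemburg_norm M UNIV (\<lambda>i. f i + t * g i) \<le> ennreal N"
    if "0 < N" "M (1 / N) + M (\<bar>t\<bar> / N) \<le> 1" for t N
  proof -
    have "luxemburg_norm M UNIV (\<lambda>i. f i + t * g i)
        = luxemburg_norm M I (\<lambda>i. 1 * basic_vector k i + t * basic_vector j i)"
      using T_norm[OF in_space[of 1 t]] unfolding T_comb .
    also have "\<dots> \<le> ennreal N"
      using that k j by (intro two_point_norm_le) auto
    finally show ?thesis .
  qed
  have norm_basic: "luxemburg_norm M UNIV f = 1" "luxemburg_norm M UNIV g = 1"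
    using T_norm basic norm_basic_vector k j by (simp_all add: f_def g_def)
  note modular = norm_basic[THEN modular_eq_one]

  have disj: "f i * g i = 0" for i
  proof (rule disjoint_supports[OF modular(1) _ flat.uniformly_curved small])
    fix t :: real
    have M: "0 \<le> M \<bar>t\<bar>"
      by (simp add: nonneg)
    have "M (1 / (1 + M \<bar>t\<bar>)) + M (\<bar>t\<bar> / (1 + M \<bar>t\<bar>)) \<le> 1 / (1 + M \<bar>t\<bar>) + M \<bar>t\<bar> / (1 + M \<bar>t\<bar>)"
      using shrink[of "1 / (1 + M \<bar>t\<bar>)" 1] shrink[of "1 / (1 + M \<bar>t\<bar>)" "\<bar>t\<bar>"] one M
      by (auto intro!: add_mono)
    also have "\<dots> = 1"
      using M by (simp add: add_divide_distrib[symmetric])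
    finally show "luxemburg_norm M UNIV (\<lambda>i. f i + t * g i) \<le> ennreal (1 + M \<bar>t\<bar>)"
      using M by (intro norm_comb) auto
  qed

  obtain v where v: "0 < v" "v < 1" "M v = 1 / 2"
  proof -
    have "\<exists>v. 0 \<le> v \<and> v \<le> 1 \<and> M v = 1 / 2"
      using cont zero one by (intro IVT') (auto intro: continuous_on_subset)
    then obtain v where "0 \<le> v" "v \<le> 1" "M v = 1 / 2"
      by blast
    moreover from this have "v \<noteq> 0" "v \<noteq> 1"
      using zero one by auto
    ultimately show ?thesis
      by (intro that[of v]) auto
  qed
  have "luxemburg_norm M UNIV (\<lambda>i. f i + g i) \<le> ennreal (1 / v)"
    using norm_comb[of "1 / v" 1] v by simp
  moreover have "M v * M s < M (v * s)" if "0 < s" "s < 1" for s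
    using that v by (intro super) (auto intro: pos)
  ultimately have "\<exists>c l. f = (\<lambda>i. c * basic_vector l i)"
    by (rule single_support[OF modular disj v])
  then show "\<exists>c l. T (basic_vector k) = (\<lambda>i. c * basic_vector l i)"
    by (simp add: f_def)
qed

end
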